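(* Let $(h_1,h_2,\dots,h_k)$ be a pure $O$-sequence and put $h_0=1$. Then $h_i\le h_j$ whenever $0\le i\le j\le k-i$, and $(h_0,h_1,\dots,h_k)$ satisfies the $g$-inequalities.
   Context: Pure $O$-sequence: a sequence of non-negative integers $(h_1,\dots,h_k)$ with $h_k>0$ for which there exist monomials $m_1,\dots,m_{h_k}$ of degree $k$ in degree-one variables $x_1,\dots,x_{h_1}$ such that, for every $1\le l\le k$, $h_l$ is the number of monomials $m$ of degree $l$ in $x_1,\dots,x_{h_1}$ that divide $m_i$ for some $1\le i\le h_k$. $g$-inequalities for $(h_0,\dots,h_k)$: put $g_i=h_i-h_{i-1}$. They assert that $g_i\ge 0$ for $1\le i\le\lfloor k/2\rfloor$, and that for $1\le i<\lfloor k/2\rfloor$, if $g_i=\binom{n_i}{i}+\binom{n_{i-1}}{i-1}+\dots+\binom{n_r}{r}$ with $n_i>n_{i-1}>\dots>n_r\ge r\ge1$ (this expression is unique for $g_i>0$), then $g_{i+1}\le\binom{n_i+1}{i+1}+\binom{n_{i-1}+1}{i}+\dots+\binom{n_r+1}{r+1}$; if $g_i=0$ the bound is $g_{i+1}\le 0$. *)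

theory Defs
  imports Complex_Main "HOL-Library.Multiset"
begin

text \<open>A monomial in the variables \<open>x\<^sub>1, \<dots>, x\<^sub>n\<close> is encoded as the multiset of its variable indices:
  the multiplicity of \<open>v\<close> is the exponent of \<open>x\<^sub>v\<close>, the degree is \<^term>\<open>size\<close>, and divisibility
  is \<open>\<subseteq>#\<close>.\<close>

definition monomials :: "nat \<Rightarrow> nat \<Rightarrow> nat multiset set" where
  "monomials n d = {m. set_mset m \<subseteq> {1..n} \<and> size m = d}"

text \<open>A sequence \<open>(h\<^sub>1, \<dots>, h\<^sub>k)\<close> is given by its length \<open>k\<close> and a function \<open>h\<close>, of which only the
  values on \<open>{1..k}\<close> matter.\<close>

definition pure_O_sequence :: "nat \<Rightarrow> (nat \<Rightarrow> nat) \<Rightarrow> bool" where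
  "pure_O_sequence k h \<longleftrightarrow>
     1 \<le> k \<and> 0 < h k \<and>
     (\<exists>M :: nat \<Rightarrow> nat multiset.
        (\<forall>i\<in>{1..h k}. M i \<in> monomials (h 1) k) \<and>
        (\<forall>l\<in>{1..k}. h l = card {m \<in> monomials (h 1) l. \<exists>i\<in>{1..h k}. m \<subseteq># M i}))"

definition g_seq :: "(nat \<Rightarrow> nat) \<Rightarrow> nat \<Rightarrow> int" where
  "g_seq h i = int (h i) - int (h (i - 1))"

text \<open>\<open>macaulay_rep i a r n\<close>: the expansion
  \<open>a = (n\<^sub>i choose i) + (n\<^sub>i\<^sub>-\<^sub>1 choose (i - 1)) + \<dots> + (n\<^sub>r choose r)\<close>
  with \<open>n\<^sub>i > n\<^sub>i\<^sub>-\<^sub>1 > \<dots> > n\<^sub>r \<ge> r \<ge> 1\<close>.\<close>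

definition macaulay_rep :: "nat \<Rightarrow> int \<Rightarrow> nat \<Rightarrow> (nat \<Rightarrow> nat) \<Rightarrow> bool" where
  "macaulay_rep i a r n \<longleftrightarrow>
     1 \<le> r \<and> r \<le> i \<and> r \<le> n r \<and> (\<forall>j\<in>{r..<i}. n j < n (Suc j)) \<and>
     a = int (\<Sum>j=r..i. n j choose j)"

definition g_inequalities :: "nat \<Rightarrow> (nat \<Rightarrow> nat) \<Rightarrow> bool" where
  "g_inequalities k h \<longleftrightarrow>
     (\<forall>i. 1 \<le> i \<and> i \<le> k div 2 \<longrightarrow> 0 \<le> g_seq h i) \<and>
     (\<forall>i. 1 \<le> i \<and> i < k div 2 \<longrightarrow>
        (\<forall>r n. macaulay_rep i (g_seq h i) r n \<longrightarrow>
           g_seq h (i + 1) \<le> int (\<Sum>j=r..i. (n j + 1) choose (j + 1))) \<and>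
        (g_seq h i = 0 \<longrightarrow> g_seq h (i + 1) \<le> 0))"

end

theory Submission
  imports Defs "HOL-Library.Multiset_Order"
begin

text \<open>
  Let \<open>A\<close> be the graded algebra spanned by the divisors of the given monomials, and \<open>\<ell>\<close> the sum of
  the variables. On the divisors of a single monomial of degree \<open>k\<close>, multiplication by \<open>\<ell>\<close> is the
  raising operator of an \<open>sl\<^sub>2\<close> action, so \<open>\<ell>\<^sup>s\<close> is injective in degree \<open>i\<close> when \<open>2i + s \<le> k\<close>. An
  element of \<open>A\<close> vanishes iff its restriction to the divisors of each generator does, so the same
  holds for \<open>A\<close>; this gives \<open>h\<^sub>i \<le> h\<^sub>j\<close> (Hibi) and \<open>g\<^sub>i = dim (A / \<ell> A)\<^sub>i\<close> for \<open>2i \<le> k + 1\<close> (Hausel).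
  The leading monomials of the dual of \<open>A / \<ell> A\<close> are closed under divisors, which
  reduces the remaining inequality to Macaulay's theorem for families of monomials. That is proved
  by compressing to a shifted family, and then by induction on the degree and on the family,
  splitting off the smallest variable.
\<close>

section \<open>The Lefschetz property for divisors of a monomial\<close>

text \<open>Gaussian elimination, one equation at a time. Dimension counts below are done in
  coordinates: if an inequality failed, this would yield a nonzero solution that cannot
  exist.\<close>

lemma exists_nontrivial_kernel:
  fixes T :: "'a \<Rightarrow> 'b \<Rightarrow> real"
  assumes "finite Y" "finite X" "card Y < card X"
  shows "\<exists>c. (\<exists>x\<in>X. c x \<noteq> 0) \<and> (\<forall>y\<in>Y. (\<Sum>x\<in>X. c x * T x y) = 0)"
  using assms
proof (induction Y arbitrary: X T rule: finite_induct)
  case empty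
  then obtain x where "x \<in> X" by (auto simp: card_gt_0_iff)
  then show ?case by (intro exI[of _ "\<lambda>_. 1"]) auto
next
  case (insert y Y)
  show ?case
  proof (cases "\<forall>x\<in>X. T x y = 0")
    case True
    have "card Y < card X" using insert.prems insert.hyps by simp
    from insert.IH[OF insert.prems(1) this, of T] obtain c where
      "\<exists>x\<in>X. c x \<noteq> 0" "\<forall>y\<in>Y. (\<Sum>x\<in>X. c x * T x y) = 0" by blast
    with True show ?thesis by (intro exI[of _ c]) auto
  next
    case False
    then obtain z where z: "z \<in> X" "T z y \<noteq> 0" by blast
    let ?X = "X - {z}"
    define q where "q x = T x y / T z y" for x
    have "card Y < card ?X" using insert.prems insert.hyps z(1) by simp
    from insert.IH[OF _ this, of "\<lambda>x y'. T x y' - q x * T z y'"] insert.prems(1)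
    obtain c where c: "\<exists>x\<in>?X. c x \<noteq> 0"
      "\<forall>y'\<in>Y. (\<Sum>x\<in>?X. c x * (T x y' - q x * T z y')) = 0" by auto
    \<comment> \<open>The coefficient of the pivot \<open>z\<close> is solved from equation
      \<open>y\<close>; the other equations were reduced by multiples of row \<open>z\<close>
      beforehand.\<close>
    define c' where "c' x = (if x = z then - (\<Sum>x\<in>?X. c x * q x) else c x)" for x
    have split: "(\<Sum>x\<in>X. c' x * T x y') = (\<Sum>x\<in>?X. c x * (T x y' - q x * T z y'))" for y'
    proof -
      have "(\<Sum>x\<in>X. c' x * T x y') = c' z * T z y' + (\<Sum>x\<in>?X. c' x * T x y')"
        using z(1) insert.prems(1) by (simp add: sum.remove)
      also have "(\<Sum>x\<in>?X. c' x * T x y') = (\<Sum>x\<in>?X. c x * T x y')"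
        by (rule sum.cong) (auto simp: c'_def)
      also have "c' z * T z y' = - (\<Sum>x\<in>?X. c x * q x * T z y')"
        by (simp add: c'_def sum_distrib_right)
      finally show ?thesis by (simp add: right_diff_distrib sum_subtractf mult.assoc)
    qed
    have "(\<Sum>x\<in>X. c' x * T x y) = 0"
      unfolding split using z(2) by (auto simp: q_def intro!: sum.neutral)
    moreover have "\<forall>y'\<in>Y. (\<Sum>x\<in>X. c' x * T x y') = 0"
      using c(2) by (simp add: split)
    moreover have "\<exists>x\<in>X. c' x \<noteq> 0" using c(1) by (auto simp: c'_def)
    ultimately show ?thesis by (intro exI[of _ c']) auto
  qed
qed

text \<open>Multiplication by the sum of the variables, a function on monomials being read as a
  family of coefficients.\<close>

definition raise :: "('a multiset \<Rightarrow> real) \<Rightarrow> 'a multiset \<Rightarrow> real" where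
  "raise f m = (\<Sum>v\<in>set_mset m. f (m - {#v#}))"

definition lower :: "'a multiset \<Rightarrow> ('a multiset \<Rightarrow> real) \<Rightarrow> 'a multiset \<Rightarrow> real" where
  "lower M f m = (\<Sum>v\<in>set_mset M.
     (real (count m v) + 1) * (real (count M v) - real (count m v)) * f (add_mset v m))"

lemma size_eq_sum_count:
  assumes "finite V" "set_mset m \<subseteq> V"
  shows "size m = (\<Sum>v\<in>V. count m v)"
  unfolding size_multiset_overloaded_eq using assms
  by (intro sum.mono_neutral_left) (auto simp: not_in_iff)

lemma raise_eq_sum_if:
  assumes "finite V" "set_mset m \<subseteq> V"
  shows "raise f m = (\<Sum>v\<in>V. if v \<in># m then f (m - {#v#}) else 0)"
proof -
  have "V \<inter> {v. v \<in># m} = set_mset m" using assms(2) by auto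
  then show ?thesis unfolding raise_def using assms(1) by (simp add: sum.If_cases)
qed

text \<open>The coefficients of \<^const>\<open>lower\<close> are those that make \<^const>\<open>raise\<close> and \<^const>\<open>lower\<close> an
  \<open>sl\<^sub>2\<close> pair on the span of the divisors of \<open>M\<close>; they vanish where \<open>add_mset v m\<close> would leave
  that span.\<close>

lemma raise_lower_commutator:
  assumes "set_mset m \<subseteq> set_mset M"
  shows "raise (lower M f) m - lower M (raise f) m = (2 * real (size m) - real (size M)) * f m"
proof -
  let ?V = "set_mset M"
  define c where "c m v = (real (count m v) + 1) * (real (count M v) - real (count m v))" for m v
  define a where "a u v = (if u \<in># m then c (m - {#u#}) v * f (add_mset v (m - {#u#})) else 0)" for u v
  define b where "b u v = c m v * (if u \<in># add_mset v m then f (add_mset v m - {#u#}) else 0)" for u v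
  have diff: "a u v - b u v = (if u = v then (2 * real (count m u) - real (count M u)) * f m else 0)"
    for u v
  proof (cases "u = v")
    case True
    show ?thesis
    proof (cases "u \<in># m")
      case True
      then have "real (count m u - 1) = real (count m u) - 1"
        by (simp add: Suc_leI of_nat_diff)
      with True \<open>u = v\<close> show ?thesis
        by (simp add: a_def b_def c_def algebra_simps)
    next
      case False
      then have "count m u = 0" by (simp add: not_in_iff)
      with False \<open>u = v\<close> show ?thesis by (simp add: a_def b_def c_def)
    qed
  next
    case False
    then show ?thesis by (auto simp: a_def b_def c_def)
  qed
  have A: "raise (lower M f) m = (\<Sum>u\<in>?V. \<Sum>v\<in>?V. a u v)"
    unfolding raise_eq_sum_if[OF finite_set_mset assms]
    by (intro sum.cong) (auto simp: a_def lower_def c_def)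
  have B: "lower M (raise f) m = (\<Sum>v\<in>?V. \<Sum>u\<in>?V. b u v)"
    unfolding lower_def
  proof (intro sum.cong refl)
    fix v assume "v \<in> ?V"
    then have "set_mset (add_mset v m) \<subseteq> ?V" using assms by auto
    from raise_eq_sum_if[OF finite_set_mset this, of f]
    show "(real (count m v) + 1) * (real (count M v) - real (count m v)) * raise f (add_mset v m) = (\<Sum>u\<in>?V. b u v)"
      by (simp add: b_def c_def sum_distrib_left)
  qed
  have "raise (lower M f) m - lower M (raise f) m = (\<Sum>u\<in>?V. \<Sum>v\<in>?V. a u v - b u v)"
    unfolding A B by (subst (2) sum.swap) (simp add: sum_subtractf)
  also have "\<dots> = (\<Sum>u\<in>?V. 2 * real (count m u) - real (count M u)) * f m"
    by (simp add: diff sum_distrib_right)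
  also have "(\<Sum>u\<in>?V. 2 * real (count m u) - real (count M u)) = 2 * real (size m) - real (size M)"
    using size_eq_sum_count[OF finite_set_mset assms] size_eq_sum_count[OF finite_set_mset subset_refl, of M]
    by (simp add: sum_subtractf sum_distrib_left)
  finally show ?thesis .
qed

text \<open>Moving \<open>lower\<close> past one \<open>raise\<close> at a time contributes the
  weights \<open>2 (size m - t) - size M\<close> for \<open>t = 0, ..., s\<close>, an arithmetic
  progression with the stated sum.\<close>

lemma raise_power_lower_commutator:
  assumes "set_mset m \<subseteq> set_mset M"
  shows "(raise ^^ Suc s) (lower M f) m = lower M ((raise ^^ Suc s) f) m
    + (real s + 1) * (2 * real (size m) - real (size M) - real s) * (raise ^^ s) f m"
  using assms
proof (induction s arbitrary: m)
  case 0
  then show ?case using raise_lower_commutator[of m M f] by simp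
next
  case (Suc s)
  let ?g = "(raise ^^ Suc s) f"
  have "(raise ^^ Suc (Suc s)) (lower M f) m = (\<Sum>u\<in>set_mset m. (raise ^^ Suc s) (lower M f) (m - {#u#}))"
    by (simp add: raise_def)
  also have "\<dots> = (\<Sum>u\<in>set_mset m. lower M ?g (m - {#u#})
      + (real s + 1) * (2 * (real (size m) - 1) - real (size M) - real s) * (raise ^^ s) f (m - {#u#}))"
  proof (intro sum.cong refl)
    fix u assume u: "u \<in># m"
    have "set_mset (m - {#u#}) \<subseteq> set_mset M" using Suc.prems by (auto dest: in_diffD)
    moreover have "real (size (m - {#u#})) = real (size m) - 1"
      using u by (cases m) (auto simp: size_Diff_singleton)
    ultimately show "(raise ^^ Suc s) (lower M f) (m - {#u#}) = lower M ?g (m - {#u#})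
      + (real s + 1) * (2 * (real (size m) - 1) - real (size M) - real s) * (raise ^^ s) f (m - {#u#})"
      using Suc.IH by metis
  qed
  also have "\<dots> = raise (lower M ?g) m
      + (real s + 1) * (2 * (real (size m) - 1) - real (size M) - real s) * ?g m"
    by (simp add: raise_def sum.distrib sum_distrib_left)
  also have "raise (lower M ?g) m = lower M (raise ?g) m + (2 * real (size m) - real (size M)) * ?g m"
    using raise_lower_commutator[OF Suc.prems, of ?g] by linarith
  finally show ?case by (simp add: algebra_simps)
qed

lemma raise_power_eq_0:
  assumes "\<And>m'. m' \<subseteq># m \<Longrightarrow> size m' + s = size m \<Longrightarrow> f m' = 0"
  shows "(raise ^^ s) f m = 0"
  using assms
proof (induction s arbitrary: m)
  case (Suc s)
  have "(raise ^^ s) f (m - {#v#}) = 0" if "v \<in># m" for v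
  proof (rule Suc.IH)
    fix m' assume "m' \<subseteq># m - {#v#}" "size m' + s = size (m - {#v#})"
    moreover have "size m = Suc (size (m - {#v#}))" using that by (metis insert_DiffM size_add_mset)
    ultimately show "f m' = 0"
      by (intro Suc.prems) (auto intro: subset_mset.order_trans)
  qed
  then show ?case by (simp add: raise_def[of "(raise ^^ s) f"])
qed simp

text \<open>Outer induction on \<open>i\<close>, inner on \<open>s\<close>. If
  \<open>(raise ^^ Suc s) f\<close> vanishes, then \<open>g = lower M f\<close> satisfies
  \<open>(raise ^^ Suc s) g = c * (raise ^^ s) f\<close> in degree \<open>i + s\<close>. One more
  \<open>raise\<close> gives 0, so the outer hypothesis for \<open>i - 1\<close> and
  \<open>s + 2\<close> kills \<open>g\<close>; hence \<open>(raise ^^ s) f\<close> vanishes and the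
  inner hypothesis applies.\<close>

lemma raise_power_injective:
  assumes "2 * i + s \<le> size M"
    and "\<And>m. m \<subseteq># M \<Longrightarrow> size m = i + s \<Longrightarrow> (raise ^^ s) f m = 0"
    and "m \<subseteq># M" "size m = i"
  shows "f m = 0"
  using assms
proof (induction i arbitrary: f s m rule: less_induct)
  case (less i)
  note outer = less.IH
  from less.prems show ?case
  proof (induction s arbitrary: m)
    case 0
    then show ?case by simp
  next
    case (Suc s)
    define c where "c = (real s + 1) * (2 * real (i + s) - real (size M) - real s)"
    \<comment> \<open>The second factor is \<open>2 i + s - size M\<close>, which is negative
      because \<open>2 i + Suc s \<le> size M\<close>.\<close>
    have c: "c \<noteq> 0" using Suc.prems(1) by (auto simp: c_def)
    let ?g = "lower M f"
    have g: "(raise ^^ Suc s) ?g m = c * (raise ^^ s) f m" if m: "m \<subseteq># M" "size m = i + s" for m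
    proof -
      have "lower M ((raise ^^ Suc s) f) m = 0"
        unfolding lower_def
      proof (intro sum.neutral ballI)
        fix v
        have "add_mset v m \<subseteq># M" if "count M v \<noteq> count m v"
          using m(1) that unfolding subseteq_mset_def
          by (metis count_add_mset le_neq_implies_less Suc_leI)
        then show "(real (count m v) + 1) * (real (count M v) - real (count m v))
            * (raise ^^ Suc s) f (add_mset v m) = 0"
          using Suc.prems(2)[of "add_mset v m"] m(2) by auto
      qed
      with raise_power_lower_commutator[OF set_mset_mono[OF m(1)], of s f] m(2)
      show ?thesis by (simp add: c_def)
    qed
    have g0: "?g m' = 0" if m': "m' \<subseteq># M" "Suc (size m') = i" for m'
    proof (rule outer[of "size m'" "Suc (Suc s)"])
      show "size m' < i" "2 * size m' + Suc (Suc s) \<le> size M" using m' Suc.prems(1) by auto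
      fix m assume m: "m \<subseteq># M" "size m = size m' + Suc (Suc s)"
      have "(raise ^^ Suc (Suc s)) ?g m = (\<Sum>v\<in>set_mset m. (raise ^^ Suc s) ?g (m - {#v#}))"
        by (simp add: raise_def)
      also have "\<dots> = (\<Sum>v\<in>set_mset m. c * (raise ^^ s) f (m - {#v#}))"
        using m m' by (intro sum.cong refl g)
          (auto simp: size_Diff_singleton intro: subset_mset.order_trans[OF diff_subset_eq_self])
      also have "\<dots> = c * (raise ^^ Suc s) f m" by (simp add: raise_def sum_distrib_left)
      also have "\<dots> = 0" using Suc.prems(2)[OF m(1)] m m' by simp
      finally show "(raise ^^ Suc (Suc s)) ?g m = 0" .
    qed (use m' in auto)
    have step: "(raise ^^ s) f m = 0" if m: "m \<subseteq># M" "size m = i + s" for m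
    proof -
      have "(raise ^^ Suc s) ?g m = 0"
      proof (rule raise_power_eq_0)
        fix m' assume "m' \<subseteq># m" "size m' + Suc s = size m"
        then show "?g m' = 0" using m by (intro g0) (auto intro: subset_mset.order_trans)
      qed
      with g[OF m] c show ?thesis by simp
    qed
    show ?case
    proof (rule Suc.IH)
      show "2 * i + s \<le> size M" using Suc.prems(1) by simp
      show "(raise ^^ s) f m = 0" if "m \<subseteq># M" "size m = i + s" for m by (rule step[OF that])
    qed (use Suc.prems in auto)
  qed
qed

section \<open>Order ideals and leading monomials of the inverse system\<close>

definition order_ideal :: "'a multiset set \<Rightarrow> nat \<Rightarrow> 'a multiset set" where
  "order_ideal N d = {m. size m = d \<and> (\<exists>M\<in>N. m \<subseteq># M)}"

text \<open>The dual of the degree \<open>d + 1\<close> part (note the shift) of the monomial algebra modulo the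
  sum of the variables.\<close>

definition inverse_system :: "'a multiset set \<Rightarrow> nat \<Rightarrow> ('a multiset \<Rightarrow> real) set" where
  "inverse_system N d = {\<phi>. (\<forall>m. \<phi> m \<noteq> 0 \<longrightarrow> m \<in> order_ideal N (Suc d)) \<and>
     (\<forall>m\<in>order_ideal N d. (\<Sum>v\<in>\<Union>(set_mset ` N). \<phi> (add_mset v m)) = 0)}"

text \<open>Leading monomials in the multiset order, a total order compatible with multiplication by
  a variable.\<close>

definition leads :: "'a::linorder multiset set \<Rightarrow> nat \<Rightarrow> 'a multiset set" where
  "leads N d = {m. \<exists>\<phi>\<in>inverse_system N d. \<phi> m \<noteq> 0 \<and> (\<forall>m'. \<phi> m' \<noteq> 0 \<longrightarrow> m' \<le> m)}"

lemma finite_order_ideal [simp]: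
  assumes "finite N"
  shows "finite (order_ideal N d)"
proof (rule finite_subset)
  let ?V = "\<Union>(set_mset ` N)"
  show "order_ideal N d \<subseteq> mset ` {xs. set xs \<subseteq> ?V \<and> length xs = d}"
  proof
    fix m assume m: "m \<in> order_ideal N d"
    obtain xs where "mset xs = m" using ex_mset by blast
    with m show "m \<in> mset ` {xs. set xs \<subseteq> ?V \<and> length xs = d}"
      by (auto simp: order_ideal_def image_iff dest: mset_subset_eqD intro!: exI[of _ xs])
  qed
  show "finite (mset ` {xs. set xs \<subseteq> ?V \<and> length xs = d})"
    using assms by (intro finite_imageI finite_lists_length_eq) auto
qed

lemma order_ideal_add_msetD: "add_mset v m \<in> order_ideal N (Suc d) \<Longrightarrow> m \<in> order_ideal N d"
  unfolding order_ideal_def by (auto dest: mset_subset_eq_insertD subset_mset.less_imp_le)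

lemma raise_power_sum:
  "(raise ^^ s) (\<lambda>m. \<Sum>x\<in>X. c x * g x m) y = (\<Sum>x\<in>X. c x * (raise ^^ s) (g x) y)"
proof (induction s arbitrary: y)
  case (Suc s)
  have "(raise ^^ Suc s) (\<lambda>m. \<Sum>x\<in>X. c x * g x m) y
      = (\<Sum>v\<in>set_mset y. \<Sum>x\<in>X. c x * (raise ^^ s) (g x) (y - {#v#}))"
    by (simp add: raise_def[of "(raise ^^ s) _"] Suc)
  also have "\<dots> = (\<Sum>x\<in>X. c x * (raise ^^ Suc s) (g x) y)"
    by (subst sum.swap) (simp add: raise_def[of "(raise ^^ s) _"] sum_distrib_left)
  finally show ?case .
qed simp

text \<open>The value of \<open>(raise ^^ s) f\<close> at a divisor of \<open>M\<close> involves
  only divisors of \<open>M\<close>, so injectivity can be checked on one generator at a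
  time.\<close>

lemma order_ideal_raise_power_injective:
  assumes "\<forall>M\<in>N. size M = k" "2 * i + s \<le> k"
    and "\<And>m. m \<in> order_ideal N (i + s) \<Longrightarrow> (raise ^^ s) f m = 0"
    and "m \<in> order_ideal N i"
  shows "f m = 0"
proof -
  obtain M where M: "M \<in> N" "m \<subseteq># M" "size m = i" using assms(4) by (auto simp: order_ideal_def)
  show ?thesis
    using assms(1-3) M by (intro raise_power_injective[of i s M f m]) (auto simp: order_ideal_def)
qed

text \<open>\<open>raise ^^ (j - i)\<close> is injective from degree \<open>i\<close> to degree
  \<open>j\<close>, as \<open>2 i + (j - i) = i + j \<le> k\<close>. A drop in cardinality would
  give its matrix a kernel.\<close>

lemma card_order_ideal_mono:
  assumes "finite N" "\<forall>M\<in>N. size M = k" "i \<le> j" "i + j \<le> k"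
  shows "card (order_ideal N i) \<le> card (order_ideal N j)"
proof (rule ccontr)
  let ?X = "order_ideal N i" and ?s = "j - i"
  assume "\<not> ?thesis"
  then have "card (order_ideal N j) < card ?X" by simp
  from exists_nontrivial_kernel[OF finite_order_ideal[OF assms(1)] finite_order_ideal[OF assms(1)] this,
      of "\<lambda>x. (raise ^^ ?s) (\<lambda>m. of_bool (m = x))"]
  obtain c x where x: "x \<in> ?X" "c x \<noteq> 0"
    and c: "\<And>y. y \<in> order_ideal N j \<Longrightarrow> (\<Sum>x\<in>?X. c x * (raise ^^ ?s) (\<lambda>m. of_bool (m = x)) y) = 0"
    by blast
  let ?f = "\<lambda>m. \<Sum>x\<in>?X. c x * of_bool (m = x)"
  have "?f x = 0"
    by (rule order_ideal_raise_power_injective[OF assms(2) _ _ x(1), of ?s])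
      (use assms(3,4) c in \<open>auto simp: raise_power_sum\<close>)
  moreover have "?f x = c x" using x(1) assms(1) by (simp add: of_bool_def if_distrib cong: if_cong)
  ultimately show False using x(2) by simp
qed

lemma finite_leads [simp]: "finite N \<Longrightarrow> finite (leads N d)"
  and leads_subset: "leads N d \<subseteq> order_ideal N (Suc d)"
proof -
  show "leads N d \<subseteq> order_ideal N (Suc d)" by (auto simp: leads_def inverse_system_def)
  then show "finite N \<Longrightarrow> finite (leads N d)" by (rule finite_subset) simp
qed

text \<open>Contraction by the variable \<open>v\<close> commutes with contraction by the sum of all
  variables.\<close>

lemma inverse_system_contract:
  assumes "\<phi> \<in> inverse_system N (Suc d)"
  shows "(\<lambda>m. \<phi> (add_mset v m)) \<in> inverse_system N d"
  unfolding inverse_system_def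
proof (intro CollectI conjI allI impI ballI)
  have supp: "m \<in> order_ideal N (Suc (Suc d))" if "\<phi> m \<noteq> 0" for m
    using assms that by (auto simp: inverse_system_def)
  show "m \<in> order_ideal N (Suc d)" if "\<phi> (add_mset v m) \<noteq> 0" for m
    using supp[OF that] by (rule order_ideal_add_msetD)
  fix m assume "m \<in> order_ideal N d"
  have "(\<Sum>u\<in>\<Union>(set_mset ` N). \<phi> (add_mset v (add_mset u m)))
      = (\<Sum>u\<in>\<Union>(set_mset ` N). \<phi> (add_mset u (add_mset v m)))"
    by (intro sum.cong refl arg_cong[of _ _ \<phi>] add_mset_commute)
  also have "\<dots> = 0"
  \<comment> \<open>The linear condition on \<open>\<phi>\<close> is available only at monomials of
    the ideal; elsewhere the support of \<open>\<phi>\<close> makes every term vanish.\<close>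
  proof (cases "add_mset v m \<in> order_ideal N (Suc d)")
    case True
    then show ?thesis using assms by (simp add: inverse_system_def)
  next
    case False
    then have "\<phi> (add_mset u (add_mset v m)) = 0" for u
      using supp[of "add_mset u (add_mset v m)"] order_ideal_add_msetD[of u "add_mset v m"] by auto
    then show ?thesis by simp
  qed
  finally show "(\<Sum>u\<in>\<Union>(set_mset ` N). \<phi> (add_mset v (add_mset u m))) = 0" .
qed

text \<open>Contract a function with leading monomial \<open>m\<close> by \<open>v\<close>:
  cancelling \<open>v\<close> preserves the multiset order. This is the closure under divisors that
  Macaulay's theorem needs.\<close>

lemma leads_shadow:
  assumes "m \<in> leads N (Suc d)" "v \<in># m"
  shows "m - {#v#} \<in> leads N d"
proof -
  obtain \<phi> where \<phi>: "\<phi> \<in> inverse_system N (Suc d)" "\<phi> m \<noteq> 0" "\<And>m'. \<phi> m' \<noteq> 0 \<Longrightarrow> m' \<le> m"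
    using assms(1) by (auto simp: leads_def)
  have m: "add_mset v (m - {#v#}) = m" using assms(2) by simp
  have "m' \<le> m - {#v#}" if "\<phi> (add_mset v m') \<noteq> 0" for m'
  proof -
    have "{#v#} + m' \<le> {#v#} + (m - {#v#})" using \<phi>(3)[OF that] m by simp
    then show ?thesis by (simp only: add_le_cancel_left)
  qed
  then show ?thesis
    unfolding leads_def using \<phi>(2) m
    by (intro CollectI bexI[OF _ inverse_system_contract[OF \<phi>(1), of v]]) simp
qed

text \<open>Otherwise the functions supported off \<open>leads N d\<close> would have more
  coefficients than there are conditions, one per monomial of degree \<open>d\<close>. A nonzero
  solution would lie in the inverse system with its leading monomial outside
  \<open>leads N d\<close>.\<close>

lemma card_order_ideal_Suc_le:
  assumes "finite N"
  shows "card (order_ideal N (Suc d)) \<le> card (order_ideal N d) + card (leads N d)"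
proof (rule ccontr)
  let ?V = "\<Union>(set_mset ` N)" and ?X = "order_ideal N (Suc d) - leads N d"
  assume "\<not> ?thesis"
  moreover have "card ?X = card (order_ideal N (Suc d)) - card (leads N d)"
    using assms leads_subset by (intro card_Diff_subset) auto
  ultimately have less: "card (order_ideal N d) < card ?X" by simp
  have "finite ?X" using assms by simp
  from exists_nontrivial_kernel[OF finite_order_ideal[OF assms] this less, of "\<lambda>x y. \<Sum>v\<in>?V. of_bool (add_mset v y = x)"]
  obtain c :: "'a multiset \<Rightarrow> real" where c0: "\<exists>x\<in>?X. c x \<noteq> 0"
    and c: "\<forall>y\<in>order_ideal N d. (\<Sum>x\<in>?X. c x * (\<Sum>v\<in>?V. of_bool (add_mset v y = x))) = 0"
    by blast
  from c0 obtain x where x: "x \<in> ?X" "c x \<noteq> 0" ..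
  define \<phi> where "\<phi> m = (if m \<in> ?X then c m else 0)" for m
  have \<phi>_eq: "\<phi> m = (\<Sum>x\<in>?X. c x * of_bool (m = x))" for m
    using assms by (simp add: \<phi>_def of_bool_def if_distrib cong: if_cong)
  have "(\<Sum>v\<in>?V. \<phi> (add_mset v y)) = 0" if "y \<in> order_ideal N d" for y
    using bspec[OF c that] unfolding \<phi>_eq by (subst sum.swap) (simp only: sum_distrib_left)
  then have \<phi>: "\<phi> \<in> inverse_system N d" by (auto simp: inverse_system_def \<phi>_def split: if_splits)
  let ?S = "{m. \<phi> m \<noteq> 0}"
  have S: "finite ?S" "?S \<subseteq> ?X"
    by (rule finite_subset[of _ ?X]) (use assms in \<open>auto simp: \<phi>_def split: if_splits\<close>)
  have "x \<in> ?S" using x by (simp add: \<phi>_def)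
  then have "Max ?S \<in> ?S" using S(1) by (intro Max_in) auto
  moreover have "\<forall>m'. \<phi> m' \<noteq> 0 \<longrightarrow> m' \<le> Max ?S" using S(1) by simp
  ultimately have "Max ?S \<in> leads N d" using \<phi> unfolding leads_def by blast
  with \<open>Max ?S \<in> ?S\<close> S(2) show False by blast
qed

text \<open>Multiplication by the sum of the variables is adjoint to contraction by it, and
  contraction kills \<open>\<phi>\<close>.\<close>

lemma raise_orthogonal_inverse_system:
  assumes "finite N" "\<phi> \<in> inverse_system N d"
  shows "(\<Sum>m\<in>order_ideal N (Suc d). raise f m * \<phi> m) = 0"
proof -
  let ?V = "\<Union>(set_mset ` N)" and ?I = "order_ideal N (Suc d)"
  have fin: "finite ?V" using assms(1) by auto
  have "(\<Sum>m\<in>?I. raise f m * \<phi> m) = (\<Sum>m\<in>?I. \<Sum>v\<in>?V. if v \<in># m then f (m - {#v#}) * \<phi> m else 0)"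
  proof (intro sum.cong refl)
    fix m assume "m \<in> ?I"
    then have "set_mset m \<subseteq> ?V" by (auto simp: order_ideal_def dest: mset_subset_eqD)
    from raise_eq_sum_if[OF fin this, of f]
    show "raise f m * \<phi> m = (\<Sum>v\<in>?V. if v \<in># m then f (m - {#v#}) * \<phi> m else 0)"
      by (simp add: sum_distrib_right if_distrib[of "\<lambda>x. x * _"] cong: if_cong)
  qed
  also have "\<dots> = (\<Sum>v\<in>?V. \<Sum>m\<in>?I. if v \<in># m then f (m - {#v#}) * \<phi> m else 0)"
    by (rule sum.swap)
  also have "\<dots> = (\<Sum>v\<in>?V. \<Sum>m\<in>order_ideal N d. f m * \<phi> (add_mset v m))"
  proof (rule sum.cong[OF refl])
    fix v
    let ?J = "{m. add_mset v m \<in> ?I}"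
    have J: "?J \<subseteq> order_ideal N d" by (auto intro: order_ideal_add_msetD)
    have img: "add_mset v ` ?J = {m \<in> ?I. v \<in># m}"
      by (auto simp: image_iff) (metis insert_DiffM)
    have "(\<Sum>m\<in>?I. if v \<in># m then f (m - {#v#}) * \<phi> m else 0) = (\<Sum>m\<in>{m \<in> ?I. v \<in># m}. f (m - {#v#}) * \<phi> m)"
      using assms(1) by (simp add: sum.inter_filter)
    also have "\<dots> = (\<Sum>m\<in>?J. f m * \<phi> (add_mset v m))"
      unfolding img[symmetric] by (subst sum.reindex) (auto simp: inj_on_def)
    also have "\<dots> = (\<Sum>m\<in>order_ideal N d. f m * \<phi> (add_mset v m))"
      using assms J by (intro sum.mono_neutral_left) (auto simp: inverse_system_def)
    finally show "(\<Sum>m\<in>?I. if v \<in># m then f (m - {#v#}) * \<phi> m else 0)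
      = (\<Sum>m\<in>order_ideal N d. f m * \<phi> (add_mset v m))" .
  qed
  also have "\<dots> = (\<Sum>m\<in>order_ideal N d. f m * (\<Sum>v\<in>?V. \<phi> (add_mset v m)))"
    by (subst sum.swap) (simp add: sum_distrib_left)
  also have "\<dots> = 0" using assms(2) by (auto simp: inverse_system_def intro!: sum.neutral)
  finally show ?thesis .
qed

lemma inverse_system_sum:
  assumes "\<And>s. s \<in> S \<Longrightarrow> \<phi> s \<in> inverse_system N d"
  shows "(\<lambda>m. \<Sum>s\<in>S. c s * \<phi> s m) \<in> inverse_system N d"
  unfolding inverse_system_def
proof (intro CollectI conjI allI impI ballI)
  fix m assume "(\<Sum>s\<in>S. c s * \<phi> s m) \<noteq> 0"
  then obtain s where "s \<in> S" "c s * \<phi> s m \<noteq> 0" by (rule sum.not_neutral_contains_not_neutral)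
  then show "m \<in> order_ideal N (Suc d)" using assms[of s] by (auto simp: inverse_system_def)
next
  fix m assume m: "m \<in> order_ideal N d"
  have "(\<Sum>v\<in>\<Union>(set_mset ` N). \<Sum>s\<in>S. c s * \<phi> s (add_mset v m))
      = (\<Sum>s\<in>S. c s * (\<Sum>v\<in>\<Union>(set_mset ` N). \<phi> s (add_mset v m)))"
    by (subst sum.swap) (simp add: sum_distrib_left)
  also have "\<dots> = 0" using assms m by (intro sum.neutral) (auto simp: inverse_system_def)
  finally show "(\<Sum>v\<in>\<Union>(set_mset ` N). \<Sum>s\<in>S. c s * \<phi> s (add_mset v m)) = 0" .
qed

text \<open>The images under \<open>raise\<close> of the unit vectors in degree \<open>d\<close>,
  together with one function per leading monomial, are linearly independent in degree
  \<open>Suc d\<close>. In a relation the two parts are orthogonal, hence both zero; the first is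
  handled by injectivity of \<open>raise\<close>, the second by distinct leading monomials.\<close>

lemma card_leads_le:
  assumes "finite N" "\<forall>M\<in>N. size M = k" "2 * d + 1 \<le> k"
  shows "card (order_ideal N d) + card (leads N d) \<le> card (order_ideal N (Suc d))"
proof (rule ccontr)
  let ?I = "order_ideal N d" and ?I' = "order_ideal N (Suc d)" and ?S = "leads N d"
  have "\<forall>s\<in>?S. \<exists>\<phi>\<in>inverse_system N d. \<phi> s \<noteq> 0 \<and> (\<forall>m'. \<phi> m' \<noteq> 0 \<longrightarrow> m' \<le> s)"
    by (simp add: leads_def)
  then obtain \<phi> where \<phi>: "\<And>s. s \<in> ?S \<Longrightarrow> \<phi> s \<in> inverse_system N d"
    "\<And>s. s \<in> ?S \<Longrightarrow> \<phi> s s \<noteq> 0" "\<And>s m'. s \<in> ?S \<Longrightarrow> \<phi> s m' \<noteq> 0 \<Longrightarrow> m' \<le> s"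
    by metis
  have fin: "finite ?I" "finite ?S" "finite ?I'" using assms(1) by auto
  assume "\<not> ?thesis"
  then have "card ?I' < card (?I <+> ?S)" using fin by (simp add: card_Plus)
  moreover have "finite (?I <+> ?S)" using fin by simp
  ultimately have "\<exists>c. (\<exists>x\<in>?I <+> ?S. c x \<noteq> 0) \<and>
      (\<forall>y\<in>?I'. (\<Sum>x\<in>?I <+> ?S. c x * case_sum (\<lambda>x. raise (\<lambda>m. of_bool (m = x))) \<phi> x y) = 0)"
    by (intro exists_nontrivial_kernel[OF fin(3)])
  then obtain c z where z: "z \<in> ?I <+> ?S" "c z \<noteq> 0"
    and c: "\<And>y. y \<in> ?I' \<Longrightarrow> (\<Sum>x\<in>?I <+> ?S. c x * case_sum (\<lambda>x. raise (\<lambda>m. of_bool (m = x))) \<phi> x y) = 0"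
    by blast
  let ?f = "\<lambda>m. \<Sum>x\<in>?I. c (Inl x) * of_bool (m = x)"
  let ?\<psi> = "\<lambda>m. \<Sum>s\<in>?S. c (Inr s) * \<phi> s m"
  have sum0: "raise ?f y + ?\<psi> y = 0" if "y \<in> ?I'" for y
    using c[OF that] fin raise_power_sum[of 1 "\<lambda>x. c (Inl x)" "\<lambda>x m. of_bool (m = x)" ?I y]
    by (simp add: sum.Plus)
  have \<psi>: "?\<psi> \<in> inverse_system N d" using \<phi>(1) by (rule inverse_system_sum)
  \<comment> \<open>Positivity over the reals: \<open>?\<psi> = - raise ?f\<close> on the ideal is
    orthogonal to itself.\<close>
  have "(\<Sum>m\<in>?I'. ?\<psi> m * ?\<psi> m) = - (\<Sum>m\<in>?I'. raise ?f m * ?\<psi> m)"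
    unfolding sum_negf[symmetric]
  proof (intro sum.cong refl)
    fix m assume "m \<in> ?I'"
    from sum0[OF this] have "raise ?f m = - ?\<psi> m" by linarith
    then show "?\<psi> m * ?\<psi> m = - (raise ?f m * ?\<psi> m)" by (simp only: mult_minus_left minus_minus)
  qed
  also have "\<dots> = 0" using raise_orthogonal_inverse_system[OF assms(1) \<psi>, of ?f] by simp
  finally have "\<forall>m\<in>?I'. ?\<psi> m * ?\<psi> m = 0"
    using fin(3) by (subst (asm) sum_nonneg_eq_0_iff) auto
  then have \<psi>0: "?\<psi> m = 0" if "m \<in> ?I'" for m using that by simp
  have f0: "?f m = 0" if "m \<in> ?I" for m
    by (rule order_ideal_raise_power_injective[OF assms(2) _ _ that, of 1])
      (use assms(3) sum0 \<psi>0 in auto)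
  have "c (Inl x) = 0" if "x \<in> ?I" for x
    using f0[OF that] that fin(1) by (simp add: of_bool_def if_distrib cong: if_cong)
  moreover have "c (Inr s) = 0" if "s \<in> ?S" for s
  proof (rule ccontr)
    assume "c (Inr s) \<noteq> 0"
    let ?T = "{s \<in> ?S. c (Inr s) \<noteq> 0}"
    \<comment> \<open>At the largest index \<open>t\<close> with nonzero coefficient, only
      \<open>\<phi> t\<close> contributes.\<close>
    have "Max ?T \<in> ?T" using fin(2) that \<open>c (Inr s) \<noteq> 0\<close> by (intro Max_in) auto
    then obtain t where t: "t \<in> ?S" "c (Inr t) \<noteq> 0" "t = Max ?T" by blast
    have "c (Inr s) * \<phi> s t = 0" if "s \<in> ?S - {t}" for s
    proof (rule ccontr)
      assume nz: "c (Inr s) * \<phi> s t \<noteq> 0"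
      then have "s \<le> t" unfolding t(3) using that fin(2) by (intro Max_ge) auto
      moreover have "t \<le> s" using \<phi>(3)[of s t] nz that by auto
      ultimately show False using that by auto
    qed
    then have "(\<Sum>s\<in>?S - {t}. c (Inr s) * \<phi> s t) = 0" by (rule sum.neutral[OF ballI])
    then have "?\<psi> t = c (Inr t) * \<phi> t t" using t(1) fin(2) by (simp add: sum.remove)
    with \<psi>0[of t] t \<phi>(2) leads_subset[of N d] show False by auto
  qed
  ultimately show False using z by auto
qed

section \<open>Macaulay representations\<close>

text \<open>A Macaulay representation \<open>n\<^sub>r < \<dots> < n\<^sub>d\<close> is encoded as a strictly increasing sequence
  with \<open>e j = n\<^sub>j\<^sub>+\<^sub>1\<close>, padded below by \<open>e j = j\<close> (so that these binomials vanish)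
  and extended arbitrarily above.\<close>

definition mac :: "nat \<Rightarrow> (nat \<Rightarrow> nat) \<Rightarrow> nat" where
  "mac d e = (\<Sum>j<d. e j choose Suc j)"

definition mac_up :: "nat \<Rightarrow> (nat \<Rightarrow> nat) \<Rightarrow> nat" where
  "mac_up d e = (\<Sum>j<d. Suc (e j) choose Suc (Suc j))"

text \<open>Represents \<open>\<Sum> (n\<^sub>j - 1 choose j)\<close>; the padding \<open>e j = j\<close> is kept so that the sequence
  stays strictly increasing.\<close>

definition pred_rep :: "(nat \<Rightarrow> nat) \<Rightarrow> nat \<Rightarrow> nat" where
  "pred_rep e j = (if e j = j then j else e j - 1)"

lemma mac_0 [simp]: "mac 0 e = 0" and mac_up_0 [simp]: "mac_up 0 e = 0"
  by (simp_all add: mac_def mac_up_def)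

lemma mac_Suc: "mac (Suc d) e = mac d e + (e d choose Suc d)"
  and mac_up_Suc: "mac_up (Suc d) e = mac_up d e + (Suc (e d) choose Suc (Suc d))"
  by (simp_all add: mac_def mac_up_def)

text \<open>Pascal's rule: the top binomial leaves a gap of \<open>e d choose d\<close>, and the
  lower terms stay below it since \<open>e (d - 1) < e d\<close>.\<close>

lemma mac_less: "strict_mono e \<Longrightarrow> mac (Suc d) e < Suc (e d) choose Suc d"
proof (induction d)
  case (Suc d)
  have "e d < e (Suc d)" using Suc.prems by (simp add: strict_mono_def)
  then have "Suc (e d) choose Suc d \<le> e (Suc d) choose Suc d" by (intro binomial_right_mono) auto
  with Suc show ?case by (simp add: mac_Suc[of "Suc d"])
qed (simp add: mac_Suc)

lemma mac_up_less: "strict_mono e \<Longrightarrow> mac_up (Suc d) e < Suc (Suc (e d)) choose Suc (Suc d)"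
proof (induction d)
  case (Suc d)
  have "e d < e (Suc d)" using Suc.prems by (simp add: strict_mono_def)
  then have "Suc (Suc (e d)) choose Suc (Suc d) \<le> Suc (e (Suc d)) choose Suc (Suc d)"
    by (intro binomial_right_mono) auto
  with Suc show ?case by (simp add: mac_up_Suc[of "Suc d"])
qed (simp add: mac_up_Suc)

lemma mac_top_less:
  assumes "strict_mono e" "e d < e' d"
  shows "mac (Suc d) e < mac (Suc d) e'" "mac_up (Suc d) e < mac_up (Suc d) e'"
proof -
  have "Suc (e d) choose Suc d \<le> e' d choose Suc d"
    "Suc (Suc (e d)) choose Suc (Suc d) \<le> Suc (e' d) choose Suc (Suc d)"
    using assms(2) by (auto intro!: binomial_right_mono simp del: binomial_Suc_Suc)
  with mac_less[OF assms(1), of d] mac_up_less[OF assms(1), of d]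
  show "mac (Suc d) e < mac (Suc d) e'" "mac_up (Suc d) e < mac_up (Suc d) e'"
    by (simp_all add: mac_Suc mac_up_Suc del: binomial_Suc_Suc)
qed

text \<open>Both sums order strictly increasing sequences lexicographically from the top entry down,
  so \<open>mac_up\<close> depends only on the value of \<open>mac\<close>, and strictly
  monotonically.\<close>

lemma mac_up_compare:
  assumes "strict_mono e" "strict_mono e'"
  shows "(mac d e < mac d e' \<longrightarrow> mac_up d e < mac_up d e') \<and> (mac d e = mac d e' \<longrightarrow> mac_up d e = mac_up d e')"
proof (induction d)
  case (Suc d)
  consider "e d < e' d" | "e' d < e d" | "e d = e' d" by linarith
  then show ?case
  proof cases
    case 1
    then show ?thesis using mac_top_less[OF assms(1), of d e'] by auto
  next
    case 2
    then show ?thesis using mac_top_less[OF assms(2), of d e] by auto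
  next
    case 3
    then show ?thesis using Suc by (simp add: mac_Suc mac_up_Suc)
  qed
qed simp

lemma mac_up_mono:
  assumes "strict_mono e" "strict_mono e'" "mac d e \<le> mac d e'"
  shows "mac_up d e \<le> mac_up d e'"
  using mac_up_compare[OF assms(1,2), of d] assms(3) by (auto simp: le_less)

lemma binomial_add_ge: "a < (a + Suc k) choose Suc k"
proof (induction a)
  case (Suc a)
  have "0 < (a + Suc k) choose k" by (rule zero_less_binomial) simp
  moreover have "(Suc a + Suc k) choose Suc k = ((a + Suc k) choose k) + ((a + Suc k) choose Suc k)"
    unfolding add_Suc by (rule binomial_Suc_Suc)
  ultimately show ?case using Suc by linarith
qed simp

text \<open>Greedy choice: the top entry is the largest \<open>N\<close> with
  \<open>N choose Suc d \<le> a\<close>. By Pascal's rule the remainder is below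
  \<open>N choose d\<close>, which forces the lower entries below \<open>N\<close>.\<close>

lemma mac_exists:
  assumes "0 < d"
  shows "\<exists>e. strict_mono e \<and> mac d e = a"
  using assms
proof (induction d arbitrary: a)
  case (Suc d)
  show ?case
  proof (cases "d = 0")
    case True
    then show ?thesis by (intro exI[of _ "\<lambda>j. a + j"]) (auto simp: strict_mono_def mac_def)
  next
    case False
    define N where "N = (LEAST N. a < Suc N choose Suc d)"
    have "\<exists>N. a < Suc N choose Suc d" using binomial_add_ge[of a d] by (intro exI[of _ "a + d"]) simp
    then have up: "a < Suc N choose Suc d" unfolding N_def by (rule LeastI_ex)
    have lo: "N choose Suc d \<le> a"
    proof (cases N)
      case (Suc K)
      then have "\<not> a < Suc K choose Suc d" unfolding N_def by (intro not_less_Least) simp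
      then show ?thesis using Suc by simp
    qed simp
    obtain e where e: "strict_mono e" "mac d e = a - (N choose Suc d)" using Suc.IH False by blast
    have less: "e j < N" if "j < d" for j
    proof (rule ccontr)
      assume "\<not> e j < N"
      moreover have "e j \<le> e (d - 1)" by (rule strict_mono_leD[OF e(1)]) (use that in simp)
      ultimately have "N choose d \<le> e (d - 1) choose d" by (intro binomial_right_mono) auto
      moreover have "e (d - 1) choose d \<le> mac d e"
        using mac_Suc[of "d - 1" e] False by simp
      ultimately show False using up e(2) lo by simp
    qed
    let ?e = "\<lambda>j. if j < d then e j else N + (j - d)"
    have "strict_mono ?e"
    proof (rule strict_monoI)
      fix x y :: nat
      assume "x < y"
      then show "?e x < ?e y" using less[of x] strict_monoD[OF e(1), of x y] by auto
    qed
    moreover have "mac (Suc d) ?e = a" using e(2) lo by (simp add: mac_def)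
    ultimately show ?thesis by blast
  qed
qed simp

lemma strict_mono_pred_rep:
  assumes "strict_mono e"
  shows "strict_mono (pred_rep e)"
  unfolding strict_mono_Suc_iff
proof
  fix j
  have "j \<le> e j" "Suc j \<le> e (Suc j)" "e j < e (Suc j)"
    using assms strict_mono_imp_increasing by (auto simp: strict_mono_def)
  then show "pred_rep e j < pred_rep e (Suc j)" by (auto simp: pred_rep_def)
qed

lemma mac_pred_rep: "mac d (pred_rep e) = (\<Sum>j<d. (e j - 1) choose Suc j)"
  unfolding mac_def pred_rep_def by (intro sum.cong) (auto simp: binomial_eq_0)

text \<open>Pascal's rule in every term. It mirrors the splitting of a family in
  \<open>shifted_card_bound\<close>: \<open>mac d e\<close> accounts for the link, the other summand
  for the deletion.\<close>

lemma mac_up_eq: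
  shows "mac_up d e = mac d e + mac_up d (pred_rep e)"
proof -
  have "Suc (e j) choose Suc (Suc j) = (e j choose Suc j) + (Suc (pred_rep e j) choose Suc (Suc j))" for j
    by (cases "e j") (auto simp: pred_rep_def)
  then show ?thesis by (simp add: mac_def mac_up_def sum.distrib del: binomial_Suc_Suc)
qed

text \<open>Pascal's rule again; \<open>card_deletion_step\<close> compares the first summand with
  the deletion and the rest with the link. The bottom term contributes \<open>1\<close> unless
  \<open>e 0 = 0\<close> is padding.\<close>

lemma mac_Suc_split:
  assumes "strict_mono e"
  shows "mac (Suc d) e = mac (Suc d) (pred_rep e) + of_bool (e 0 \<noteq> 0) + mac d (\<lambda>j. e (Suc j) - 1)"
proof -
  have "e (Suc j) choose Suc (Suc j) = ((e (Suc j) - 1) choose Suc (Suc j)) + ((e (Suc j) - 1) choose Suc j)" for j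
    using strict_mono_imp_increasing[OF assms, of "Suc j"] by (cases "e (Suc j)") auto
  moreover have "e 0 = (e 0 - 1) + of_bool (e 0 \<noteq> 0)" by auto
  ultimately show ?thesis
    unfolding mac_pred_rep unfolding mac_def sum.lessThan_Suc_shift by (simp add: sum.distrib)
qed

lemma mac_Suc_eq_up:
  assumes "strict_mono e"
  shows "mac (Suc d) e = e 0 + mac_up d (\<lambda>j. e (Suc j) - 1)"
proof -
  have "Suc (e (Suc j) - 1) = e (Suc j)" for j
    using strict_mono_imp_increasing[OF assms, of "Suc j"] by simp
  then show ?thesis
    unfolding mac_def mac_up_def sum.lessThan_Suc_shift by simp
qed

lemma strict_mono_shift:
  fixes e :: "nat \<Rightarrow> nat"
  assumes "strict_mono e"
  shows "strict_mono (\<lambda>j. e (Suc j) - 1)"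
  unfolding strict_mono_Suc_iff
proof
  fix j
  have "Suc j \<le> e (Suc j)" "e (Suc j) < e (Suc (Suc j))"
    using assms strict_mono_imp_increasing by (auto simp: strict_mono_def)
  then show "e (Suc j) - 1 < e (Suc (Suc j)) - 1" by simp
qed

section \<open>Shifted families\<close>

text \<open>Strongly stable families in the variables from \<open>s\<close> on; \<open>s\<close> is
  a parameter because deleting the smallest variable passes to \<open>Suc s\<close>.\<close>

definition shifted :: "nat \<Rightarrow> nat multiset set \<Rightarrow> bool" where
  "shifted s F \<longleftrightarrow> (\<forall>m\<in>F. set_mset m \<subseteq> {s..} \<and>
     (\<forall>q\<in>#m. \<forall>p\<in>{s..<q}. add_mset p (m - {#q#}) \<in> F))"

definition link :: "'a \<Rightarrow> 'a multiset set \<Rightarrow> 'a multiset set" where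
  "link s F = {m. add_mset s m \<in> F}"

definition deletion :: "'a \<Rightarrow> 'a multiset set \<Rightarrow> 'a multiset set" where
  "deletion s F = {m \<in> F. s \<notin># m}"

lemma card_deletion_link:
  assumes "finite F"
  shows "card F = card (deletion s F) + card (link s F)" "finite (link s F)" "finite (deletion s F)"
proof -
  have F: "F = deletion s F \<union> add_mset s ` link s F"
    unfolding deletion_def link_def using multi_member_split by fastforce
  show fin: "finite (deletion s F)" using assms by (simp add: deletion_def)
  have "finite (add_mset s ` link s F)" using assms by (rule finite_subset[rotated]) (auto simp: link_def)
  then show fin': "finite (link s F)" by (rule finite_imageD) (simp add: inj_on_def)
  have "card F = card (deletion s F) + card (add_mset s ` link s F)"
    by (subst F, rule card_Un_disjoint) (use fin fin' in \<open>auto simp: deletion_def\<close>)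
  then show "card F = card (deletion s F) + card (link s F)" by (simp add: card_image inj_on_def)
qed

text \<open>A variable \<open>v\<close> other than \<open>s\<close> can first be replaced by
  \<open>s\<close>. Thus the link contains the whole shadow.\<close>

lemma shifted_shadow_in_link:
  assumes "shifted s F" "m \<in> F" "v \<in># m"
  shows "m - {#v#} \<in> link s F"
proof -
  have "v = s \<or> s \<in> {s..<v}" using assms unfolding shifted_def by force
  with assms show ?thesis unfolding shifted_def link_def by auto
qed

lemma shifted_link:
  assumes "shifted s F"
  shows "shifted s (link s F)"
  unfolding shifted_def
proof (intro ballI conjI)
  fix m assume m: "m \<in> link s F"
  then have m': "add_mset s m \<in> F" by (simp add: link_def)
  with assms show "set_mset m \<subseteq> {s..}" unfolding shifted_def by fastforce
  fix q p assume q: "q \<in># m" "p \<in> {s..<q}"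
  then have "add_mset p (add_mset s m - {#q#}) \<in> F"
    using assms m' unfolding shifted_def by (metis union_single_eq_member insert_noteq_member insert_iff set_mset_add_mset_insert)
  moreover have "add_mset p (add_mset s m - {#q#}) = add_mset s (add_mset p (m - {#q#}))"
    using q by (simp add: add_mset_commute diff_union_swap2)
  ultimately show "add_mset p (m - {#q#}) \<in> link s F" by (simp add: link_def)
qed

lemma shifted_deletion:
  assumes "shifted s F"
  shows "shifted (Suc s) (deletion s F)"
  unfolding shifted_def
proof (intro ballI conjI)
  fix m assume m: "m \<in> deletion s F"
  then have "set_mset m \<subseteq> {s..}" "s \<notin># m" using assms unfolding shifted_def deletion_def by auto
  then show "set_mset m \<subseteq> {Suc s..}" by (auto simp: Suc_le_eq le_less)
  fix q p assume q: "q \<in># m" "p \<in> {Suc s..<q}"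
  then have "add_mset p (m - {#q#}) \<in> F" using assms m unfolding shifted_def deletion_def by simp
  with q m show "add_mset p (m - {#q#}) \<in> deletion s F" by (auto simp: deletion_def dest: in_diffD)
qed

text \<open>Makes the recursion on the deletion possible: its link is controlled by the deletion of
  the link, a family of lower degree.\<close>

lemma link_deletion_subset:
  assumes "shifted s F"
  shows "link (Suc s) (deletion s F) \<subseteq> deletion s (link s F)"
proof
  fix m assume "m \<in> link (Suc s) (deletion s F)"
  then have m: "add_mset (Suc s) m \<in> F" "s \<notin># m" by (auto simp: link_def deletion_def)
  with shifted_shadow_in_link[OF assms m(1), of "Suc s"] show "m \<in> deletion s (link s F)"
    by (simp add: deletion_def)
qed

text \<open>If the deletion were too large, the link would be so small that \<open>bound\<close> contradicts the size
  of \<open>G\<close>.\<close>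

lemma card_deletion_step:
  assumes bound: "\<And>F e. shifted s F \<Longrightarrow> finite F \<Longrightarrow> \<forall>m\<in>F. size m = Suc d \<Longrightarrow> strict_mono e \<Longrightarrow>
      card (link s F) \<le> mac d e \<Longrightarrow> card F \<le> mac_up d e"
    and G: "shifted s G" "finite G" "\<forall>m\<in>G. size m = Suc d"
    and e: "strict_mono e" "card G = mac (Suc d) e"
  shows "card (deletion s G) \<le> mac (Suc d) (pred_rep e)"
proof (rule ccontr)
  assume contr: "\<not> ?thesis"
  let ?e = "\<lambda>j. e (Suc j) - 1"
  note e' = strict_mono_shift[OF e(1)]
  have less: "card (link s G) < of_bool (e 0 \<noteq> 0) + mac d ?e"
    using contr mac_Suc_split[OF e(1), of d] e(2) card_deletion_link(1)[OF G(2), of s] by linarith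
  have G_eq: "card G = e 0 + mac_up d ?e" using e mac_Suc_eq_up by simp
  \<comment> \<open>The link has size at most \<open>mac d ?e\<close>, and strictly less if
    \<open>e 0 = 0\<close>. Either way \<open>bound\<close> puts \<open>card G\<close> below its
    actual value \<open>e 0 + mac_up d ?e\<close>.\<close>
  show False
  proof (cases "e 0 = 0")
    case False
    then have "card G \<le> mac_up d ?e" using less by (intro bound G e') simp
    with G_eq False show False by simp
  next
    case True
    then have lt: "card (link s G) < mac d ?e" using less by simp
    then have "0 < d" by (cases d) auto
    then obtain e2 where e2: "strict_mono e2" "mac d e2 = card (link s G)" using mac_exists by blast
    have "card G \<le> mac_up d e2" using e2 by (intro bound G) auto
    also have "\<dots> < mac_up d ?e" using mac_up_compare[OF e2(1) e', of d] e2(2) lt by simp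
    finally show False using G_eq True by simp
  qed
qed

text \<open>Outer induction on the degree, inner on \<open>card F\<close>. Let \<open>e'\<close>
  represent the size of the link. By \<open>card_deletion_step\<close> in the lower degree, the link
  of the deletion has size at most \<open>mac (Suc d) (pred_rep e')\<close>; the inner hypothesis
  bounds the deletion, and \<open>mac_up_eq\<close> adds both parts up to
  \<open>mac_up (Suc d) e'\<close>.\<close>

lemma shifted_card_bound:
  assumes "shifted s F" "finite F" "\<forall>m\<in>F. size m = Suc d" "strict_mono e"
    and "card (link s F) \<le> mac d e"
  shows "card F \<le> mac_up d e"
  using assms
proof (induction d arbitrary: s F e)
  case 0
  have "F = {}"
  proof (rule ccontr)
    assume "F \<noteq> {}"
    then obtain m v where "m \<in> F" "v \<in># m" using "0.prems"(3)
      by (metis ex_in_conv size_eq_Suc_imp_elem)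
    then have "link s F \<noteq> {}" using shifted_shadow_in_link[OF "0.prems"(1)] by blast
    with "0.prems"(5) card_deletion_link(2)[OF "0.prems"(2)] show False by simp
  qed
  then show ?case by simp
next
  case (Suc d)
  note lower = Suc.IH
  from Suc.prems show ?case
  proof (induction "card F" arbitrary: s F e rule: less_induct)
    case (less F s e)
    show ?case
    proof (cases "F = {}")
      case False
      let ?G = "link s F" and ?F = "deletion s F"
      note fin = card_deletion_link(2,3)[OF less.prems(2)]
      obtain m v where "m \<in> F" "v \<in># m" using less.prems(3) False
        by (metis ex_in_conv size_eq_Suc_imp_elem)
      then have "?G \<noteq> {}" using shifted_shadow_in_link[OF less.prems(1)] by blast
      then have smaller: "card ?F < card F"
        using card_deletion_link(1)[OF less.prems(2), of s] fin by (simp add: card_gt_0_iff)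
      obtain e' where e': "strict_mono e'" "mac (Suc d) e' = card ?G" using mac_exists by blast
      have "card (link (Suc s) ?F) \<le> card (deletion s ?G)"
        by (rule card_mono[OF card_deletion_link(3)[OF fin(1)] link_deletion_subset[OF less.prems(1)]])
      also have "\<dots> \<le> mac (Suc d) (pred_rep e')"
        using less.prems(3) e' by (intro card_deletion_step lower shifted_link less.prems(1) fin) (auto simp: link_def)
      finally have "card ?F \<le> mac_up (Suc d) (pred_rep e')"
        using less.prems(3) by (intro less.hyps[OF smaller shifted_deletion[OF less.prems(1)] fin(2)] strict_mono_pred_rep e')
          (auto simp: deletion_def)
      then have "card F \<le> mac_up (Suc d) e'"
        using card_deletion_link(1)[OF less.prems(2), of s] e'(2) mac_up_eq[of "Suc d" e'] by simp
      also have "\<dots> \<le> mac_up (Suc d) e" using e' less.prems by (intro mac_up_mono) auto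
      finally show ?thesis .
    qed simp
  qed
qed

section \<open>Compression\<close>

definition rank :: "nat set \<Rightarrow> nat \<Rightarrow> nat" where
  "rank X x = card {b \<in> X. b < x}"

lemma rank_le: "rank X x \<le> x"
proof -
  have "card {b \<in> X. b < x} \<le> card {..<x}" by (rule card_mono) auto
  then show ?thesis by (simp add: rank_def)
qed

lemma bij_betw_rank:
  assumes "finite X"
  shows "bij_betw (rank X) X {..<card X}"
proof -
  have less: "rank X x < rank X y" if "x \<in> X" "x < y" for x y
    unfolding rank_def by (rule psubset_card_mono) (use assms that in auto)
  have inj: "inj_on (rank X) X"
  proof (rule inj_onI)
    fix x y assume "x \<in> X" "y \<in> X" "rank X x = rank X y"
    then show "x = y" using less[of x y] less[of y x] by (cases x y rule: linorder_cases) auto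
  qed
  have "rank X x < card X" if "x \<in> X" for x
    unfolding rank_def by (rule psubset_card_mono) (use assms that in auto)
  then have "rank X ` X = {..<card X}"
    using inj by (intro card_subset_eq) (auto simp: card_image)
  with inj show ?thesis by (simp add: bij_betw_def)
qed

text \<open>Shifting the part above a gap of \<open>X\<close> down by one embeds \<open>X\<close> into its shadow \<open>Y\<close>.\<close>

lemma card_line_shadow:
  fixes X Y :: "nat set"
  assumes "finite Y" "X \<subseteq> {..E}"
    and same: "\<And>b. b \<in> X \<Longrightarrow> b < E \<Longrightarrow> b \<in> Y"
    and pred: "\<And>b. b \<in> X \<Longrightarrow> 0 < b \<Longrightarrow> b - 1 \<in> Y"
  shows "min (card X) E \<le> card Y"
proof (cases "X = {..E}")
  \<comment> \<open>A full line has \<open>E + 1\<close> points but forces only \<open>E\<close>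
    points into \<open>Y\<close>, whence the \<open>min\<close>.\<close>
  case True
  have "{..<E} \<subseteq> Y" using same True by auto
  from card_mono[OF assms(1) this] show ?thesis by simp
next
  case False
  then obtain z where z: "z \<le> E" "z \<notin> X" using assms(2) by auto
  define f where "f b = (if b < z then b else b - 1)" for b
  have "inj_on f X"
  proof (rule inj_onI)
    fix x y assume "x \<in> X" "y \<in> X" and eq: "f x = f y"
    then have "x \<noteq> z" "y \<noteq> z" using z(2) by auto
    with eq show "x = y" by (auto simp: f_def split: if_splits)
  qed
  moreover have "f ` X \<subseteq> Y"
  proof
    fix y assume "y \<in> f ` X"
    then obtain b where b: "b \<in> X" "y = f b" by blast
    have "b \<noteq> z" using b z by auto
    then show "y \<in> Y" using b z same[of b] pred[of b] by (cases "b < z") (auto simp: f_def)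
  qed
  ultimately have "card X \<le> card Y" using assms(1) by (rule card_inj_on_le)
  then show ?thesis by simp
qed

definition pairdeg :: "'a \<Rightarrow> 'a \<Rightarrow> 'a multiset \<Rightarrow> nat" where
  "pairdeg p q m = count m p + count m q"

text \<open>Coordinates on the line through \<open>m\<close>: its points are given by their exponent
  \<open>b\<close> of \<open>q\<close>, for \<open>b\<close> up to \<open>pairdeg p q m\<close>.
  Beyond that the truncated subtraction leaves the line, hence the guard in
  \<open>slice\<close>.\<close>

definition slide :: "'a \<Rightarrow> 'a \<Rightarrow> 'a multiset \<Rightarrow> nat \<Rightarrow> 'a multiset" where
  "slide p q m b = filter_mset (\<lambda>x. x \<noteq> p \<and> x \<noteq> q) m
     + replicate_mset (pairdeg p q m - b) p + replicate_mset b q"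

definition slice :: "'a \<Rightarrow> 'a \<Rightarrow> 'a multiset set \<Rightarrow> 'a multiset \<Rightarrow> nat set" where
  "slice p q F m = {b. b \<le> pairdeg p q m \<and> slide p q m b \<in> F}"

definition compress_mset :: "'a \<Rightarrow> 'a \<Rightarrow> 'a multiset set \<Rightarrow> 'a multiset \<Rightarrow> 'a multiset" where
  "compress_mset p q F m = slide p q m (rank (slice p q F m) (count m q))"

text \<open>On each line \<open>{w \<cdot> x\<^sub>p\<^sup>a x\<^sub>q\<^sup>b. a + b = const}\<close> the members of \<open>F\<close> are replaced by equally many
  with the smallest exponents of \<open>x\<^sub>q\<close>. Moving single members by one step instead would not
  preserve shadow containment.\<close>

definition compress :: "'a \<Rightarrow> 'a \<Rightarrow> 'a multiset set \<Rightarrow> 'a multiset set" where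
  "compress p q F = {m. count m q < card (slice p q F m)}"

definition shadow_closed :: "'a multiset set \<Rightarrow> 'a multiset set \<Rightarrow> bool" where
  "shadow_closed A B \<longleftrightarrow> (\<forall>m\<in>B. \<forall>v\<in>#m. m - {#v#} \<in> A)"

lemma finite_slice [simp]: "finite (slice p q F m)"
  by (rule finite_subset[of _ "{..pairdeg p q m}"]) (auto simp: slice_def)

lemma count_slide:
  assumes "p \<noteq> q"
  shows "count (slide p q m b) x =
    (if x = p then pairdeg p q m - b else if x = q then b else count m x)"
  using assms by (auto simp: slide_def)

context
  fixes p q :: 'a
  assumes pq: "p \<noteq> q"
begin

lemma slide_self [simp]: "slide p q m (count m q) = m"
  by (rule multiset_eqI) (auto simp: count_slide[OF pq] pairdeg_def)

lemma pairdeg_slide [simp]: "b \<le> pairdeg p q m \<Longrightarrow> pairdeg p q (slide p q m b) = pairdeg p q m"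
  using pq by (subst pairdeg_def) (auto simp: count_slide[OF pq])

lemma slide_slide [simp]: "b \<le> pairdeg p q m \<Longrightarrow> slide p q (slide p q m b) c = slide p q m c"
  by (rule multiset_eqI) (auto simp: count_slide[OF pq])

lemma slice_slide [simp]: "b \<le> pairdeg p q m \<Longrightarrow> slice p q F (slide p q m b) = slice p q F m"
  by (simp add: slice_def)

lemma count_le_pairdeg [simp]: "count m q \<le> pairdeg p q m"
  by (simp add: pairdeg_def)

lemma count_slide_q [simp]: "count (slide p q m b) q = b"
  using pq by (simp add: count_slide[OF pq])

lemma rank_le_pairdeg: "rank X (count m q) \<le> pairdeg p q m"
  using rank_le[of X "count m q"] count_le_pairdeg[of m] by linarith

lemma size_slide: "b \<le> pairdeg p q m \<Longrightarrow> size (slide p q m b) = size m"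
proof -
  assume b: "b \<le> pairdeg p q m"
  have "size (slide p q m (count m q)) = size m" by simp
  then have "size m = size (filter_mset (\<lambda>x. x \<noteq> p \<and> x \<noteq> q) m) + pairdeg p q m"
    by (simp only: slide_def pairdeg_def size_union size_replicate_mset)
  with b show ?thesis by (simp add: slide_def)
qed

text \<open>A line and its slice can be recovered from any of its points, and on each line
  \<open>rank\<close> numbers the members of \<open>F\<close> from 0.\<close>

lemma bij_betw_compress: "bij_betw (compress_mset p q F) F (compress p q F)"
  unfolding bij_betw_def
proof
  show "inj_on (compress_mset p q F) F"
  proof (rule inj_onI)
    fix m m' assume m: "m \<in> F" "m' \<in> F" "compress_mset p q F m = compress_mset p q F m'"
    let ?r = "\<lambda>m. rank (slice p q F m) (count m q)"
    have eq: "slide p q m (?r m) = slide p q m' (?r m')" using m(3) by (simp add: compress_mset_def)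
    have line: "slide p q m c = slide p q m' c" for c
      using arg_cong[OF eq, of "\<lambda>x. slide p q x c"] by (simp add: rank_le_pairdeg)
    have sl: "slice p q F m = slice p q F m'"
      using arg_cong[OF eq, of "slice p q F"] by (simp add: rank_le_pairdeg)
    have "?r m = ?r m'" using arg_cong[OF eq, of "\<lambda>x. count x q"] by simp
    moreover have "count m q \<in> slice p q F m" "count m' q \<in> slice p q F m'"
      using m by (simp_all add: slice_def)
    ultimately have cnt: "count m q = count m' q"
      using bij_betw_imp_inj_on[OF bij_betw_rank[OF finite_slice, of p q F m']] sl by (simp add: inj_on_eq_iff)
    have "slide p q m (count m q) = slide p q m' (count m' q)" by (simp only: line cnt)
    then show "m = m'" by (simp only: slide_self)
  qed
  show "compress_mset p q F ` F = compress p q F"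
  proof (intro equalityI subsetI)
    fix y assume "y \<in> compress_mset p q F ` F"
    then obtain m where m: "m \<in> F" "y = compress_mset p q F m" by blast
    have "count m q \<in> slice p q F m" using m by (simp add: slice_def)
    then have "rank (slice p q F m) (count m q) < card (slice p q F m)"
      using bij_betw_apply[OF bij_betw_rank[OF finite_slice, of p q F m]] by simp
    then show "y \<in> compress p q F"
      by (simp add: m(2) compress_def compress_mset_def rank_le_pairdeg)
  next
    fix y assume "y \<in> compress p q F"
    then have "count y q \<in> rank (slice p q F y) ` slice p q F y"
      using bij_betw_rank[OF finite_slice, of p q F y] by (simp add: compress_def bij_betw_def)
    then obtain b where b: "b \<in> slice p q F y" "count y q = rank (slice p q F y) b" by blast
    then have bd: "b \<le> pairdeg p q y" "slide p q y b \<in> F" by (auto simp: slice_def)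
    have "compress_mset p q F (slide p q y b) = slide p q y (rank (slice p q F y) b)"
      using bd(1) by (simp add: compress_mset_def)
    also have "\<dots> = y" by (simp only: b(2)[symmetric] slide_self)
    finally show "y \<in> compress_mset p q F ` F" using bd(2) by (rule image_eqI[OF sym])
  qed
qed

lemma card_compress: "card (compress p q F) = card F"
  by (rule bij_betw_same_card[OF bij_betw_compress, symmetric])

lemma finite_compress: "finite F \<Longrightarrow> finite (compress p q F)"
  using bij_betw_finite[OF bij_betw_compress, of F] by simp

lemma size_compress:
  assumes "\<forall>m\<in>F. size m = d"
  shows "\<forall>m\<in>compress p q F. size m = d"
proof -
  have "compress p q F = compress_mset p q F ` F" using bij_betw_imp_surj_on[OF bij_betw_compress, of F] by (rule sym)
  with assms show ?thesis by (auto simp: compress_mset_def size_slide rank_le_pairdeg)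
qed

text \<open>Removing a third variable maps lines to lines of equal length, and slices embed.
  Removing \<open>p\<close> or \<open>q\<close> leads to the same line, one shorter, where exponent
  \<open>c\<close> of \<open>q\<close> becomes \<open>c\<close> or \<open>c - 1\<close>; this is the
  situation of \<open>card_line_shadow\<close>.\<close>

lemma shadow_closed_compress:
  assumes "shadow_closed A B"
  shows "shadow_closed (compress p q A) (compress p q B)"
  unfolding shadow_closed_def
proof (intro ballI)
  fix m v assume m: "m \<in> compress p q B" and v: "v \<in># m"
  let ?X = "slice p q B m" and ?Y = "slice p q A (m - {#v#})"
  have b: "count m q < card ?X" using m by (simp add: compress_def)
  have v1: "1 \<le> count m v" using v by simp
  show "m - {#v#} \<in> compress p q A"
  proof (cases "v = p \<or> v = q")
    case False
    have deg: "pairdeg p q (m - {#v#}) = pairdeg p q m" using False by (simp add: pairdeg_def)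
    have "?X \<subseteq> ?Y"
    proof
      fix c assume c: "c \<in> ?X"
      have "v \<in># slide p q m c" using False v by (simp add: slide_def)
      then have "slide p q m c - {#v#} \<in> A" using assms c by (auto simp: shadow_closed_def slice_def)
      also have "slide p q m c - {#v#} = slide p q (m - {#v#}) c"
        by (rule multiset_eqI) (use False deg in \<open>auto simp: count_slide[OF pq]\<close>)
      finally show "c \<in> ?Y" using c deg by (simp add: slice_def)
    qed
    then have "card ?X \<le> card ?Y" by (rule card_mono[OF finite_slice])
    then show ?thesis using b False by (simp add: compress_def)
  next
    case True
    let ?E = "pairdeg p q m"
    have deg: "pairdeg p q (m - {#v#}) = ?E - 1" using True v1 pq by (auto simp: pairdeg_def)
    have E: "1 \<le> ?E" using True v by (auto simp: pairdeg_def Suc_le_eq)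
    have "min (card ?X) ?E \<le> card ?Y"
    proof (rule card_line_shadow)
      show "?X \<subseteq> {..?E}" by (auto simp: slice_def)
      show "c \<in> ?Y" if c: "c \<in> ?X" "c < ?E" for c
      proof -
        have "p \<in># slide p q m c" using c(2) by (simp add: slide_def)
        then have "slide p q m c - {#p#} \<in> A" using assms c by (auto simp: shadow_closed_def slice_def)
        also have "slide p q m c - {#p#} = slide p q (m - {#v#}) c"
          by (rule multiset_eqI) (use True deg pq in \<open>auto simp: count_slide[OF pq]\<close>)
        finally show ?thesis using c deg by (simp add: slice_def)
      qed
      show "c - 1 \<in> ?Y" if c: "c \<in> ?X" "0 < c" for c
      proof -
        have "q \<in># slide p q m c" using c(2) by (simp add: slide_def)
        then have "slide p q m c - {#q#} \<in> A" using assms c by (auto simp: shadow_closed_def slice_def)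
        also have "slide p q m c - {#q#} = slide p q (m - {#v#}) (c - 1)"
          by (rule multiset_eqI) (use True deg pq c in \<open>auto simp: count_slide[OF pq]\<close>)
        finally show ?thesis using c deg by (auto simp: slice_def intro: diff_le_mono)
      qed
    qed simp
    \<comment> \<open>For \<open>v = p\<close> some factor \<open>p\<close> keeps the exponent of
      \<open>q\<close> below \<open>?E\<close>; for \<open>v = q\<close> that exponent drops by
      one.\<close>
    moreover have "count (m - {#v#}) q < min (card ?X) ?E"
      using True b v1 E pq by (auto simp: pairdeg_def)
    ultimately have "count (m - {#v#}) q < card ?Y" by linarith
    then show ?thesis unfolding compress_def by (rule CollectI)
  qed
qed

text \<open>Slices of a compressed family are initial segments, so the exponent of \<open>q\<close>
  may be lowered by one.\<close>

lemma compress_fixed_exchange: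
  assumes "compress p q F = F" "m \<in> F" "q \<in># m"
  shows "add_mset p (m - {#q#}) \<in> F"
proof -
  have c: "1 \<le> count m q" using assms(3) by simp
  have "count m q < card (slice p q F m)" using assms(1,2) by (auto simp: compress_def)
  moreover have "count m q - 1 \<le> pairdeg p q m" using count_le_pairdeg[of m] by linarith
  ultimately have "slide p q m (count m q - 1) \<in> compress p q F" by (simp add: compress_def)
  moreover have "slide p q m (count m q - 1) = add_mset p (m - {#q#})"
    by (rule multiset_eqI) (use c pq in \<open>auto simp: count_slide[OF pq] pairdeg_def\<close>)
  ultimately show ?thesis using assms(1) by simp
qed

end

section \<open>Termination of repeated compression\<close>

lemma sum_mset_slide_mono:
  fixes p q :: nat
  assumes "p < q" "b \<le> c" "c \<le> pairdeg p q m"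
  shows "\<Sum>\<^sub># (slide p q m b) \<le> \<Sum>\<^sub># (slide p q m c)"
    and "b < c \<Longrightarrow> \<Sum>\<^sub># (slide p q m b) < \<Sum>\<^sub># (slide p q m c)"
proof -
  have sum: "\<Sum>\<^sub># (slide p q m b) = \<Sum>\<^sub># (filter_mset (\<lambda>x. x \<noteq> p \<and> x \<noteq> q) m) + pairdeg p q m * p + b * (q - p)"
    if "b \<le> pairdeg p q m" for b
  proof -
    define u where "u = pairdeg p q m - b"
    have u: "pairdeg p q m = b + u" using that by (simp add: u_def)
    define r where "r = q - p"
    have r: "q = p + r" using assms(1) by (simp add: r_def)
    have "\<Sum>\<^sub># (slide p q m b) = \<Sum>\<^sub># (filter_mset (\<lambda>x. x \<noteq> p \<and> x \<noteq> q) m) + (u * p + b * q)"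
      unfolding slide_def u by simp
    moreover have "u * p + b * q = (b + u) * p + b * (q - p)"
      using r by (simp add: algebra_simps)
    ultimately show ?thesis unfolding u by simp
  qed
  have "b \<le> pairdeg p q m" using assms by simp
  note eqs = sum[OF this] sum[OF assms(3)]
  show "\<Sum>\<^sub># (slide p q m b) \<le> \<Sum>\<^sub># (slide p q m c)"
    unfolding eqs using assms(2) by simp
  show "\<Sum>\<^sub># (slide p q m b) < \<Sum>\<^sub># (slide p q m c)" if "b < c"
    unfolding eqs using that assms(1) by simp
qed

text \<open>The total of all variable indices is the termination measure: no member gains weight,
  and one that moves trades copies of \<open>q\<close> for the smaller \<open>p\<close>.\<close>

lemma weight_compress_less:
  fixes F :: "nat multiset set"
  assumes "p < q" "finite F" "compress p q F \<noteq> F"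
  shows "(\<Sum>m\<in>compress p q F. \<Sum>\<^sub># m) < (\<Sum>m\<in>F. \<Sum>\<^sub># m)"
proof -
  have pq: "p \<noteq> q" using assms(1) by simp
  let ?r = "\<lambda>m. rank (slice p q F m) (count m q)"
  note bij = bij_betw_compress[OF pq, of F]
  have slide_m: "\<Sum>\<^sub># m = \<Sum>\<^sub># (slide p q m (count m q))" for m using slide_self[OF pq, of m] by simp
  have le: "\<Sum>\<^sub># (compress_mset p q F m) \<le> \<Sum>\<^sub># m" for m
    unfolding compress_mset_def
    by (subst (2) slide_m) (intro sum_mset_slide_mono assms(1) rank_le count_le_pairdeg[OF pq])
  have "\<exists>m\<in>F. compress_mset p q F m \<noteq> m"
  proof (rule ccontr)
    assume "\<not> ?thesis"
    then have "compress_mset p q F ` F = F" by (auto simp: image_iff)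
    then show False using bij assms(3) by (simp add: bij_betw_def)
  qed
  then obtain m where m: "m \<in> F" "compress_mset p q F m \<noteq> m" by blast
  have "?r m \<noteq> count m q" using m(2) slide_self[OF pq, of m] by (auto simp: compress_mset_def)
  then have "?r m < count m q" using rank_le[of "slice p q F m" "count m q"] by linarith
  then have "\<Sum>\<^sub># (compress_mset p q F m) < \<Sum>\<^sub># m"
    unfolding compress_mset_def
    by (subst (2) slide_m) (intro sum_mset_slide_mono(2) assms(1) rank_le count_le_pairdeg[OF pq])
  then have "(\<Sum>m\<in>F. \<Sum>\<^sub># (compress_mset p q F m)) < (\<Sum>m\<in>F. \<Sum>\<^sub># m)"
    using m(1) le assms(2) by (intro sum_strict_mono_ex1) auto
  also have "(\<Sum>m\<in>F. \<Sum>\<^sub># (compress_mset p q F m)) = (\<Sum>m\<in>compress p q F. \<Sum>\<^sub># m)"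
    by (rule sum.reindex_bij_betw[OF bij])
  finally show ?thesis .
qed

text \<open>\<open>A\<close> is compressed along with \<open>B\<close> at each step, so that shadow
  containment persists while the weight of \<open>B\<close> decreases.\<close>

lemma exists_compressed:
  fixes A B :: "nat multiset set"
  assumes "finite A" "finite B" "\<forall>m\<in>B. size m = d" "shadow_closed A B"
  shows "\<exists>A' B' :: nat multiset set. finite A' \<and> finite B' \<and> (\<forall>m\<in>B'. size m = d) \<and> shadow_closed A' B' \<and>
    card A' = card A \<and> card B' = card B \<and> (\<forall>p q. p < q \<longrightarrow> compress p q B' = B')"
  using assms
proof (induction "\<Sum>m\<in>B. \<Sum>\<^sub># m" arbitrary: A B rule: less_induct)
  case (less B A)
  show ?case
  proof (cases "\<forall>p q. p < q \<longrightarrow> compress p q B = B")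
    case True
    then show ?thesis using less.prems by blast
  next
    case False
    then obtain p q where pq: "p < q" "compress p q B \<noteq> B" by blast
    then have ne: "p \<noteq> q" by simp
    show ?thesis
      using less.hyps[OF weight_compress_less[OF pq(1) less.prems(2) pq(2)] finite_compress[OF ne less.prems(1)]
          finite_compress[OF ne less.prems(2)] size_compress[OF ne less.prems(3)] shadow_closed_compress[OF ne less.prems(4)]]
      by (simp add: card_compress[OF ne])
  qed
qed

section \<open>The g-inequalities\<close>

text \<open>After compression \<open>B'\<close> is shifted, and its link at variable 0 lies in
  \<open>A'\<close> because it is part of the shadow.\<close>

lemma macaulay_bound:
  fixes A B :: "nat multiset set"
  assumes "finite A" "finite B" "\<forall>m\<in>B. size m = Suc d" "shadow_closed A B"
    and "strict_mono e" "card A \<le> mac d e"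
  shows "card B \<le> mac_up d e"
proof -
  obtain A' B' :: "nat multiset set" where fin: "finite A'" "finite B'" and size: "\<forall>m\<in>B'. size m = Suc d"
    and closed: "shadow_closed A' B'" and card: "card A' = card A" "card B' = card B"
    and fixed: "\<And>p q. p < q \<Longrightarrow> compress p q B' = B'"
    using exists_compressed[OF assms(1-4)] by blast
  have "shifted 0 B'"
    unfolding shifted_def
  proof (intro ballI conjI)
    fix m q p assume "m \<in> B'" "q \<in># m" "p \<in> {0..<q}"
    then show "add_mset p (m - {#q#}) \<in> B'"
      by (intro compress_fixed_exchange fixed) auto
  qed auto
  moreover have "link 0 B' \<subseteq> A'" using closed by (force simp: link_def shadow_closed_def)
  then have "card (link 0 B') \<le> mac d e"
    using card_mono[OF fin(1), of "link 0 B'"] card(1) assms(6) by simp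
  ultimately have "card B' \<le> mac_up d e"
    by (intro shifted_card_bound[of 0] fin size assms(5))
  then show ?thesis by (simp add: card(2))
qed

lemma macaulay_rep_eq_mac:
  assumes "macaulay_rep i a r n"
  obtains e where "strict_mono e" "a = int (mac i e)" "(\<Sum>j=r..i. (n j + 1) choose (j + 1)) = mac_up i e"
proof -
  obtain s where s: "r = Suc s" using assms by (cases r) (auto simp: macaulay_rep_def)
  have si: "s < i" and ns: "Suc s \<le> n (Suc s)"
    and less: "\<And>j. Suc s \<le> j \<Longrightarrow> j < i \<Longrightarrow> n j < n (Suc j)"
    and a: "a = int (\<Sum>j=Suc s..i. n j choose j)"
    using assms s by (auto simp: macaulay_rep_def)
  \<comment> \<open>Below \<open>s\<close> stands padding with vanishing binomials, from
    \<open>i\<close> on an arbitrary increasing continuation; \<open>Suc s \<le> n (Suc s)\<close>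
    makes the join at \<open>s\<close> strict.\<close>
  define e where "e j = (if j < s then j else if j < i then n (Suc j) else n i + (Suc j - i))" for j
  have "strict_mono e"
    unfolding strict_mono_Suc_iff
  proof
    fix j
    show "e j < e (Suc j)"
    proof -
      consider "Suc j < s" | "Suc j = s" | "s \<le> j" "Suc j < i" | "Suc j = i" "s \<le> j" | "i \<le> j"
        using si by linarith
      then show ?thesis
      proof cases
        case 2
        then show ?thesis using ns si by (auto simp: e_def)
      next
        case 3
        then show ?thesis using less[of "Suc j"] by (simp add: e_def)
      qed (use si in \<open>auto simp: e_def\<close>)
    qed
  qed
  moreover have shift: "(\<Sum>j<i. f j) = (\<Sum>j=Suc s..i. g j)"
    if "\<And>j. j < s \<Longrightarrow> f j = 0" "\<And>j. s \<le> j \<Longrightarrow> j < i \<Longrightarrow> f j = g (Suc j)" for f g :: "nat \<Rightarrow> nat"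
  proof -
    have "(\<Sum>j<i. f j) = (\<Sum>j=s..<i. f j)"
      by (rule sum.mono_neutral_right) (use that(1) in auto)
    also have "\<dots> = (\<Sum>j=s..<i. g (Suc j))" by (rule sum.cong) (use that(2) in auto)
    also have "\<dots> = (\<Sum>j=Suc s..i. g j)"
      unfolding sum.shift_bounds_Suc_ivl[symmetric] atLeastLessThanSuc_atLeastAtMost ..
    finally show ?thesis .
  qed
  have "mac i e = (\<Sum>j=Suc s..i. n j choose j)"
    unfolding mac_def by (rule shift) (auto simp: e_def binomial_eq_0)
  moreover have "mac_up i e = (\<Sum>j=Suc s..i. (n j + 1) choose (j + 1))"
    unfolding mac_up_def by (rule shift) (auto simp: e_def binomial_eq_0)
  ultimately show ?thesis using that[of e] a s by simp
qed

theorem theorem6p2: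
  fixes h :: "nat \<Rightarrow> nat" and k :: nat
  assumes "pure_O_sequence k h"
    and "h 0 = 1"
  shows "(\<forall>i j. i \<le> j \<and> i + j \<le> k \<longrightarrow> h i \<le> h j) \<and> g_inequalities k h"
proof -
  obtain M where M: "1 \<le> k" "0 < h k" "\<forall>i\<in>{1..h k}. M i \<in> monomials (h 1) k"
    "\<forall>l\<in>{1..k}. h l = card {m \<in> monomials (h 1) l. \<exists>i\<in>{1..h k}. m \<subseteq># M i}"
    using assms(1) unfolding pure_O_sequence_def by blast
  define N where "N = M ` {1..h k}"
  have N: "finite N" "\<forall>m\<in>N. size m = k" using M(3) by (auto simp: N_def monomials_def)
  have ideal: "order_ideal N l = {m \<in> monomials (h 1) l. \<exists>i\<in>{1..h k}. m \<subseteq># M i}" for l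
  proof -
    have "set_mset m \<subseteq> {1..h 1}" if "m \<subseteq># M i" "i \<in> {1..h k}" for m i
      using M(3) that set_mset_mono[OF that(1)] unfolding monomials_def by blast
    then show ?thesis unfolding order_ideal_def monomials_def N_def by blast
  qed
  have h: "h l = card (order_ideal N l)" if "l \<le> k" for l
  proof (cases "l = 0")
    case True
    have "N \<noteq> {}" using M(2) by (simp add: N_def)
    then have "order_ideal N 0 = {{#}}" by (auto simp: order_ideal_def)
    with True assms(2) show ?thesis by simp
  next
    case False
    then have "l \<in> {1..k}" using that by simp
    then show ?thesis unfolding ideal by (rule bspec[OF M(4)])
  qed
  have mono: "h i \<le> h j" if "i \<le> j" "i + j \<le> k" for i j
    using card_order_ideal_mono[OF N that] h[of i] h[of j] that by simp
  have bound: "g_seq h (i + 1) \<le> int (mac_up i e)"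
    if i: "1 \<le> i" "i < k div 2" and e: "strict_mono e" "g_seq h i = int (mac i e)" for i e
  proof -
    obtain d where d: "i = Suc d" using i(1) by (cases i) auto
    \<comment> \<open>Because of the degree shift, \<open>leads N d\<close> consists of monomials of
      degree \<open>i\<close> and \<open>leads N i\<close> of monomials of degree
      \<open>i + 1\<close>.\<close>
    have "card (order_ideal N d) + card (leads N d) \<le> card (order_ideal N i)"
      unfolding d by (rule card_leads_le[OF N]) (use i d in auto)
    then have "int (card (leads N d)) \<le> g_seq h i"
      using h[of d] h[of i] i d by (simp add: g_seq_def)
    then have A: "card (leads N d) \<le> mac i e" using e(2) by simp
    have "card (order_ideal N (Suc i)) \<le> card (order_ideal N i) + card (leads N i)"
      by (rule card_order_ideal_Suc_le[OF N(1)])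
    then have "g_seq h (i + 1) \<le> int (card (leads N i))"
      using h[of i] h[of "Suc i"] i by (simp add: g_seq_def)
    moreover have "card (leads N i) \<le> mac_up i e"
    proof (rule macaulay_bound[OF _ _ _ _ e(1) A])
      show "\<forall>m\<in>leads N i. size m = Suc i" using leads_subset[of N i] by (auto simp: order_ideal_def)
      show "shadow_closed (leads N d) (leads N i)"
        unfolding shadow_closed_def d using leads_shadow by blast
    qed (use N in auto)
    ultimately show ?thesis by linarith
  qed
  have "g_inequalities k h"
    unfolding g_inequalities_def
  proof (intro conjI allI impI)
    fix i assume "1 \<le> i \<and> i \<le> k div 2"
    then have "i - 1 + i \<le> k" by linarith
    from mono[OF diff_le_self this] show "0 \<le> g_seq h i" by (simp add: g_seq_def)
  next
    fix i r n assume i: "1 \<le> i \<and> i < k div 2" and rep: "macaulay_rep i (g_seq h i) r n"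
    from rep obtain e where e: "strict_mono e" "g_seq h i = int (mac i e)"
      and up: "(\<Sum>j=r..i. (n j + 1) choose (j + 1)) = mac_up i e"
      by (rule macaulay_rep_eq_mac)
    show "g_seq h (i + 1) \<le> int (\<Sum>j=r..i. (n j + 1) choose (j + 1))"
      unfolding up by (rule bound[OF _ _ e]) (use i in auto)
  next
    fix i assume i: "1 \<le> i \<and> i < k div 2" "g_seq h i = 0"
    \<comment> \<open>The value 0 has no \<open>macaulay_rep\<close>; here it is represented by
      \<open>id\<close>, which is padding throughout.\<close>
    have "mac i id = 0" "mac_up i id = 0" "strict_mono (id :: nat \<Rightarrow> nat)"
      by (simp_all add: mac_def mac_up_def binomial_eq_0 strict_mono_def)
    then show "g_seq h (i + 1) \<le> 0" using bound[of i id] i by simp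
  qed
  with mono show ?thesis by blast
qed

end
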